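(* Let $x\in(0,\pi/2)$. (i) If $q\ge1$, then $N(\cos x;q)<\frac{\sin x}{x}<M(\cos x;q)$. (ii) If $0<q\le\frac{34}{35}$, then $M(\cos x;q)<\frac{\sin x}{x}<N(\cos x;q)$. (iii) If $q\le0$, then $\frac{\sin x}{x}>M(\cos x;q)$.
   Context: For $t\in(0,1)$ and $q\in\mathbb{R}$: $M(t;q)=\left(\frac{8}{15q}+\left(1-\frac{8}{15q}\right)t^q\right)^{5/(15q-8)}$ if $q\ne0,\frac8{15}$; $M(t;0)=\left(1-\frac8{15}\ln t\right)^{-5/8}$; $M(t;\frac8{15})=\exp\frac{5(t^{8/15}-1)}{8}$. For $q>0$: $N(t;q)=\left(\left(\frac2\pi\right)^{3q-8/5}+\left(1-\left(\frac2\pi\right)^{3q-8/5}\right)t^q\right)^{1/(3q-8/5)}$ if $q\ne\frac8{15}$, and $N(t;\frac8{15})=\left(\frac2\pi\right)^{1-t^{8/15}}$. *)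

theory Defs
  imports Complex_Main
begin

definition M :: "real \<Rightarrow> real \<Rightarrow> real" where
  "M t q = (if q = 0 then (1 - 8/15 * ln t) powr (-5/8)
            else if q = 8/15 then exp (5 * (t powr (8/15) - 1) / 8)
            else (8/(15*q) + (1 - 8/(15*q)) * t powr q) powr (5/(15*q - 8)))"

definition N :: "real \<Rightarrow> real \<Rightarrow> real" where
  "N t q = (if q = 8/15 then (2/pi) powr (1 - t powr (8/15))
            else ((2/pi) powr (3*q - 8/5) + (1 - (2/pi) powr (3*q - 8/5)) * t powr q)
                   powr (1/(3*q - 8/5)))"

end

theory Submission
  imports Defs "HOL-Real_Asymp.Real_Asymp"
begin

text \<open>
  Put \<open>p = 3q - 8/5\<close> and let \<open>B\<^sub>p(y) = (y^p - 1)/p\<close>, with \<open>B\<^sub>0 = ln\<close>. The means are characterised by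
  \<open>B\<^sub>p(M(t;q)) = B\<^sub>q(t)/3\<close> and \<open>B\<^sub>p(N(t;q)) = B\<^sub>p(2/\<pi>) (1 - t^q)\<close>. So with
  \<open>U(x) = B\<^sub>p(sin x / x)\<close> and \<open>V(x) = B\<^sub>q(cos x)\<close> all claims compare the quotient \<open>U/V\<close> with
  its values \<open>1/3\<close> at \<open>0\<close> and \<open>U(\<pi>/2)/V(\<pi>/2)\<close> at \<open>\<pi>/2\<close>. As in the monotone form of l'Hospital's rule, it suffices
  that \<open>U'/V'\<close> is increasing for \<open>q \<ge> 1\<close> and decreasing for \<open>q \<le> 34/35\<close>. The logarithmic
  derivative of \<open>U'/V'\<close> is affine and increasing in \<open>q\<close>, so only its sign at \<open>q = 1\<close> and at \<open>q = 34/35\<close>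
  matters; clearing denominators gives inequalities between trigonometric polynomials in \<open>2x\<close> and
  \<open>3x\<close>.
\<close>

section \<open>Positivity of mixed polynomials in \<open>x\<close>, \<open>sin\<close> and
  \<open>cos\<close>\<close>

lemma pos_if_deriv_pos:
  fixes f f' :: "real \<Rightarrow> real"
  assumes "\<And>y. (f has_real_derivative f' y) (at y)" "f 0 = 0"
    and "\<And>y. 0 < y \<Longrightarrow> y < b \<Longrightarrow> 0 < f' y" and "0 < x" "x < b"
  shows "0 < f x"
proof -
  have "f 0 < f x"
  proof (rule DERIV_pos_imp_increasing_open[where f = f])
    show "continuous_on {0..x} f"
      by (rule DERIV_continuous_on) (rule has_field_derivative_at_within[OF assms(1)])
  qed (use assms in fastforce)+
  then show ?thesis using assms(2) by simp
qed

lemma x_cos_less_sin: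
  fixes x :: real
  assumes "0 < x" "x < pi"
  shows "x * cos x < sin x"
proof -
  have "0 < sin x - x * cos x"
  proof (rule pos_if_deriv_pos[where f = "\<lambda>x. sin x - x * cos x" and b = pi and f' = "\<lambda>x. x * sin x"])
    show "((\<lambda>x. sin x - x * cos x) has_real_derivative y * sin y) (at y)" for y :: real
      by (auto intro!: derivative_eq_intros)
  qed (use assms in \<open>auto intro: mult_pos_pos sin_gt_zero\<close>)
  then show ?thesis by simp
qed

text \<open>Two differentiations reduce this to \<open>x_cos_less_sin\<close>. It is applied at
  \<open>2*x\<close>, hence the range up to \<open>pi\<close>.\<close>

lemma three_sin_less:
  fixes x :: real
  assumes "0 < x" "x < pi"
  shows "3 * sin x < 2 * x + x * cos x"
proof -
  have 1: "0 < 2 - 2 * cos x - x * sin x" if "0 < x" "x < pi" for x :: real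
  proof (rule pos_if_deriv_pos[where f = "\<lambda>x. 2 - 2 * cos x - x * sin x" and b = pi and f' = "\<lambda>x. sin x - x * cos x"])
    show "((\<lambda>x. 2 - 2 * cos x - x * sin x) has_real_derivative sin y - y * cos y) (at y)" for y :: real
      by (auto intro!: derivative_eq_intros)
  qed (use that x_cos_less_sin in auto)
  have "0 < 2 * x + x * cos x - 3 * sin x"
  proof (rule pos_if_deriv_pos[where f = "\<lambda>x. 2 * x + x * cos x - 3 * sin x" and b = pi and f' = "\<lambda>x. 2 - 2 * cos x - x * sin x"])
    show "((\<lambda>x. 2 * x + x * cos x - 3 * sin x) has_real_derivative 2 - 2 * cos y - y * sin y) (at y)" for y :: real
      by (auto intro!: derivative_eq_intros)
  qed (use assms 1 in auto)
  then show ?thesis by simp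
qed

text \<open>Four differentiations, each expression vanishing at 0, end in
  \<open>x * (sin x - x * cos x)\<close>. The facts \<open>3\<close>, \<open>2\<close>,
  \<open>1\<close> climb back up this chain. The argument will be \<open>2*x\<close>.\<close>

lemma trig_poly_pos_double_angle:
  fixes x :: real
  assumes "0 < x" "x < pi"
  shows "0 < 4 * x^2 - x^2 * cos x + 9 * x * sin x - 24 + 24 * cos x"
proof -
  have 3: "0 < 3 * sin x - 3 * x * cos x - x^2 * sin x" if "0 < x" "x < pi" for x :: real
  proof (rule pos_if_deriv_pos[where f = "\<lambda>x. 3 * sin x - 3 * x * cos x - x^2 * sin x" and b = pi and f' = "\<lambda>x. x * (sin x - x * cos x)"])
    show "((\<lambda>x. 3 * sin x - 3 * x * cos x - x^2 * sin x) has_real_derivative y * (sin y - y * cos y)) (at y)" for y :: real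
      by (auto intro!: derivative_eq_intros simp: algebra_simps power2_eq_square)
  qed (use that x_cos_less_sin in auto)
  have 2: "0 < 8 - 8 * cos x - 5 * x * sin x + x^2 * cos x" if "0 < x" "x < pi" for x :: real
  proof (rule pos_if_deriv_pos[where f = "\<lambda>x. 8 - 8 * cos x - 5 * x * sin x + x^2 * cos x" and b = pi and f' = "\<lambda>x. 3 * sin x - 3 * x * cos x - x^2 * sin x"])
    show "((\<lambda>x. 8 - 8 * cos x - 5 * x * sin x + x^2 * cos x) has_real_derivative 3 * sin y - 3 * y * cos y - y^2 * sin y) (at y)" for y :: real
      by (auto intro!: derivative_eq_intros simp: algebra_simps power2_eq_square)
  qed (use that 3 in auto)
  have 1: "0 < 8 * x + 7 * x * cos x + x^2 * sin x - 15 * sin x" if "0 < x" "x < pi" for x :: real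
  proof (rule pos_if_deriv_pos[where f = "\<lambda>x. 8 * x + 7 * x * cos x + x^2 * sin x - 15 * sin x" and b = pi and f' = "\<lambda>x. 8 - 8 * cos x - 5 * x * sin x + x^2 * cos x"])
    show "((\<lambda>x. 8 * x + 7 * x * cos x + x^2 * sin x - 15 * sin x) has_real_derivative 8 - 8 * cos y - 5 * y * sin y + y^2 * cos y) (at y)" for y :: real
      by (auto intro!: derivative_eq_intros simp: algebra_simps power2_eq_square)
  qed (use that 2 in auto)
  show ?thesis
  proof (rule pos_if_deriv_pos[where f = "\<lambda>x. 4 * x^2 - x^2 * cos x + 9 * x * sin x - 24 + 24 * cos x" and b = pi and f' = "\<lambda>x. 8 * x + 7 * x * cos x + x^2 * sin x - 15 * sin x"])
    show "((\<lambda>x. 4 * x^2 - x^2 * cos x + 9 * x * sin x - 24 + 24 * cos x) has_real_derivative 8 * y + 7 * y * cos y + y^2 * sin y - 15 * sin y) (at y)" for y :: real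
      by (auto intro!: derivative_eq_intros simp: algebra_simps power2_eq_square)
  qed (use assms 1 in auto)
qed

text \<open>The denominator of the bound is \<open>fact 16\<close>. The even degree 16 makes
  \<open>x^16\<close> its own absolute value, so no sign condition on \<open>x\<close>
  arises.\<close>

lemma cos_Taylor_16:
  fixes x :: real
  shows "\<bar>cos x - (1 - x^2/2 + x^4/24 - x^6/720 + x^8/40320 - x^10/3628800
            + x^12/479001600 - x^14/87178291200)\<bar> \<le> x^16 / 20922789888000"
proof -
  obtain t where t: "cos x = (\<Sum>m<16. cos_coeff m * x ^ m)
      + (cos (t + 1/2 * real 16 * pi) / fact 16) * x ^ 16"
    using Maclaurin_cos_expansion[of x 16] by blast
  have "(\<Sum>m<16. cos_coeff m * x ^ m) = 1 - x^2/2 + x^4/24 - x^6/720 + x^8/40320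
      - x^10/3628800 + x^12/479001600 - x^14/87178291200"
    by (simp add: cos_coeff_def fact_numeral lessThan_nat_numeral lessThan_Suc)
  moreover have "\<bar>(cos (t + 1/2 * real 16 * pi) / fact 16) * x ^ 16\<bar> \<le> 1 / fact 16 * x ^ 16"
    unfolding abs_mult abs_divide by (intro mult_mono frac_le) (auto intro: abs_cos_le_one)
  ultimately show ?thesis using t by (simp add: fact_numeral)
qed

lemma sin_Taylor_16:
  fixes x :: real
  shows "\<bar>sin x - (x - x^3/6 + x^5/120 - x^7/5040 + x^9/362880 - x^11/39916800
            + x^13/6227020800 - x^15/1307674368000)\<bar> \<le> x^16 / 20922789888000"
proof -
  have "(\<Sum>m<16. sin_coeff m * x ^ m) = x - x^3/6 + x^5/120 - x^7/5040 + x^9/362880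
      - x^11/39916800 + x^13/6227020800 - x^15/1307674368000"
    by (simp add: sin_coeff_def fact_numeral lessThan_nat_numeral lessThan_Suc)
  with Maclaurin_sin_bound[of x 16] show ?thesis
    by (simp add: fact_numeral field_simps)
qed

text \<open>Up to a negative factor this is the numerator of the derivative of
  \<open>log_deriv_ratio\<close> at \<open>q = 34/35\<close>, written in multiple angles so that
  Taylor polynomials can be inserted linearly.\<close>

lemma trig_poly_pos_triple_angle:
  fixes x :: real
  assumes x: "0 < x" "x < pi/2"
  shows "0 < 81 * cos x - 81 * cos (3*x) - 54 * x * sin x - 58 * x * sin (3*x)
             - 108 * x^2 * cos x + 12 * x^2 * cos (3*x)"
proof -
  \<comment> \<open>The expansion at \<open>0\<close> starts with \<open>64/525 x^10\<close>; cutting it at degree 16 keeps the remainder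
    below the main part up to \<open>x = 2\<close>.\<close>
  have x2: "x < 2" using x pi_half_less_two by linarith
  define C where "C = (\<lambda>x::real. 1 - x^2/2 + x^4/24 - x^6/720 + x^8/40320 - x^10/3628800
            + x^12/479001600 - x^14/87178291200)"
  define S where "S = (\<lambda>x::real. x - x^3/6 + x^5/120 - x^7/5040 + x^9/362880 - x^11/39916800
            + x^13/6227020800 - x^15/1307674368000)"
  define e where "e = x^16 / 20922789888000"
  define e3 where "e3 = (3*x)^16 / 20922789888000"
  have c1: "\<bar>cos x - C x\<bar> \<le> e" and c3: "\<bar>cos (3*x) - C (3*x)\<bar> \<le> e3"
    and s1: "\<bar>sin x - S x\<bar> \<le> e" and s3: "\<bar>sin (3*x) - S (3*x)\<bar> \<le> e3"
    unfolding C_def S_def e_def e3_def by (rule cos_Taylor_16 sin_Taylor_16)+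
  have scale: "\<bar>a * d\<bar> \<le> a * k" if "\<bar>d\<bar> \<le> k" "0 \<le> a" for a d k :: real
    using that by (simp add: abs_mult mult_left_mono)
  have "\<bar>x * (sin x - S x)\<bar> \<le> x * e" "\<bar>x * (sin (3*x) - S (3*x))\<bar> \<le> x * e3"
    "\<bar>x^2 * (cos x - C x)\<bar> \<le> x^2 * e" "\<bar>x^2 * (cos (3*x) - C (3*x))\<bar> \<le> x^2 * e3"
    using x by (intro scale s1 s3 c1 c3; simp)+
  note errs = this[unfolded right_diff_distrib] c1 c3
  have "0 < 64/525 - 32/1155 * x^2"
  proof -
    have "x^2 < 2^2" using x x2 by (intro power_strict_mono) auto
    then show ?thesis by simp
  qed
  \<comment> \<open>Rounded constants: \<open>44/100000\<close> exceeds the \<open>x^16\<close>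
    coefficient below plus twice that of \<open>x^17\<close>, and \<open>25/1000000\<close> exceeds
    that of \<open>x^18\<close>.\<close>
  moreover have "0 < 1528/525525 - 44/100000 * x^2 - 25/1000000 * x^4"
  proof -
    have "x^2 < 2^2" "x^4 < 2^4" using x x2 by (intro power_strict_mono; simp)+
    then show ?thesis by simp
  qed
  ultimately have "0 < x^10 * ((64/525 - 32/1155 * x^2) + x^4 * (1528/525525 - 44/100000 * x^2 - 25/1000000 * x^4))"
    using x by (intro mult_pos_pos add_pos_pos) auto
  also have "\<dots> = 64/525 * x^10 - 32/1155 * x^12 + 1528/525525 * x^14 - 44/100000 * x^16 - 25/1000000 * x^18"
    by algebra
  finally have "0 < 64/525 * x^10 - 32/1155 * x^12 + 1528/525525 * x^14 - 44/100000 * x^16 - 25/1000000 * x^18" .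
  moreover have "x^17 \<le> 2 * x^16"
    using x x2 by (simp add: numeral_eq_Suc)
  moreover have "0 < x^16" "0 < x^18" using x by auto
  ultimately have "0 < 64/525 * x^10 - 32/1155 * x^12 + 1528/525525 * x^14
      - 10438949/55351296000 * x^16 - 5779421/48432384000 * x^17 - 478297/19372953600 * x^18"
    by linarith
  \<comment> \<open>All terms of degree below 10 cancel. Degrees 17 and 18 come from the remainders
    alone.\<close>
  also have "\<dots> = 81 * C x - 81 * C (3*x) - 54 * (x * S x) - 58 * (x * S (3*x))
             - 108 * (x^2 * C x) + 12 * (x^2 * C (3*x))
             - (81 * e + 81 * e3 + 54 * (x * e) + 58 * (x * e3) + 108 * (x^2 * e) + 12 * (x^2 * e3))"
    unfolding C_def S_def e_def e3_def
    by (simp add: algebra_simps power_mult_distrib power2_eq_square flip: power_add power_Suc power_Suc2)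
  finally have "0 < \<dots>" .
  then show ?thesis using errs by (simp add: algebra_simps abs_le_iff)
qed

section \<open>The Box-Cox transform and the two means\<close>

definition box_cox :: "real \<Rightarrow> real \<Rightarrow> real" where
  "box_cox p y = (if p = 0 then ln y else (y powr p - 1) / p)"

lemma box_cox_1 [simp]: "box_cox p 1 = 0"
  by (simp add: box_cox_def)

text \<open>Dividing by \<open>p\<close> cancels the factor of the power rule, so one formula covers
  \<open>p = 0\<close> as well.\<close>

lemma DERIV_box_cox:
  assumes "(f has_real_derivative f') (at x)" "0 < f x"
  shows "((\<lambda>x. box_cox p (f x)) has_real_derivative f x powr (p - 1) * f') (at x)"
  unfolding box_cox_def using assms
  by (cases "p = 0")
     (auto intro!: derivative_eq_intros DERIV_fun_powr simp: powr_minus field_simps)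

text \<open>The derivative \<open>u powr (p - 1)\<close> is positive for every real
  \<open>p\<close>, so inequalities between means can be tested after the transform, even for
  negative \<open>p\<close>.\<close>

lemma box_cox_less_iff:
  assumes "0 < y" "0 < z"
  shows "box_cox p y < box_cox p z \<longleftrightarrow> y < z"
proof -
  have less: "box_cox p y < box_cox p z" if "0 < y" "y < z" for y z
  proof (rule DERIV_pos_imp_increasing[OF \<open>y < z\<close>])
    fix u assume "y \<le> u" "u \<le> z"
    then have "(box_cox p has_real_derivative u powr (p - 1) * 1) (at u)"
      using that DERIV_box_cox[OF DERIV_ident, of u p] by simp
    then show "\<exists>d. (box_cox p has_real_derivative d) (at u) \<and> 0 < d"
      using that \<open>y \<le> u\<close> by fastforce
  qed
  show ?thesis
    using less[of y z] less[of z y] assms by (cases y z rule: linorder_cases) auto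
qed

lemma continuous_on_box_cox_pos:
  assumes "continuous_on A f" "\<And>x. x \<in> A \<Longrightarrow> 0 < f x"
  shows "continuous_on A (\<lambda>x. box_cox p (f x))"
  unfolding box_cox_def using assms
  by (cases "p = 0") (auto intro!: continuous_intros dest: assms(2))

text \<open>Meant for \<open>cos\<close> on an interval reaching \<open>pi/2\<close>: with
  \<open>p > 0\<close>, the value \<open>0 powr p = 0\<close> is the continuous one.\<close>

lemma continuous_on_box_cox_nonneg:
  assumes "continuous_on A f" "\<And>x. x \<in> A \<Longrightarrow> 0 \<le> f x" "0 < p"
  shows "continuous_on A (\<lambda>x. box_cox p (f x))"
  unfolding box_cox_def using assms
  by (auto intro!: continuous_intros continuous_on_powr')

lemma box_cox_powr_inverse:
  assumes "p \<noteq> 0" "0 < y"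
  shows "box_cox p (y powr (1 / p)) = (y - 1) / p"
  using assms by (simp add: box_cox_def powr_powr)

lemma box_cox_M:
  assumes t: "0 < t" "t < 1"
  shows "0 < M t q" "box_cox (3 * q - 8/5) (M t q) = box_cox q t / 3"
proof -
  consider "q = 0" | "q = 8/15" | "q \<noteq> 0" "q \<noteq> 8/15" by blast
  then have "0 < M t q \<and> box_cox (3 * q - 8/5) (M t q) = box_cox q t / 3"
  proof cases
    case 1
    have "0 < 1 - 8/15 * ln t" using t ln_less_zero[of t] by linarith
    then show ?thesis
      using 1 box_cox_powr_inverse[of "-8/5" "1 - 8/15 * ln t"]
      by (simp add: M_def) (simp add: box_cox_def)
  next
    case 2
    show ?thesis unfolding 2 by (simp add: M_def box_cox_def)
  next
    case 3
    have pos: "0 < 8/(15*q) + (1 - 8/(15*q)) * t powr q"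
    proof -
      \<comment> \<open>This quotient has the same sign for positive and negative \<open>q\<close>,
        and the base is \<open>t powr q\<close> plus 8/15 of it.\<close>
      have "0 \<le> (1 - t powr q) / q"
      proof (cases "0 < q")
        case True
        then show ?thesis using t powr_less_mono2[of q t 1] by simp
      next
        case False
        then have "1 powr q \<le> t powr q" using t by (intro powr_mono2') auto
        then show ?thesis using False by (simp add: divide_nonpos_nonpos)
      qed
      moreover have "0 < t powr q" using t by simp
      moreover have "8/(15*q) + (1 - 8/(15*q)) * t powr q = 8/15 * ((1 - t powr q) / q) + t powr q"
        using 3 by (simp add: field_simps)
      ultimately show ?thesis by linarith
    qed
    have "5 / (15 * q - 8) = 1 / (3 * q - 8/5)"
      using 3 by (simp add: field_simps)
    then show ?thesis
      using 3 pos box_cox_powr_inverse[OF _ pos, of "3 * q - 8/5"]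
      by (simp add: M_def) (simp add: box_cox_def field_simps)
  qed
  then show "0 < M t q" "box_cox (3 * q - 8/5) (M t q) = box_cox q t / 3" by auto
qed

lemma box_cox_N:
  assumes t: "0 < t" "t < 1" and "0 < q"
  shows "0 < N t q" "box_cox (3 * q - 8/5) (N t q) = box_cox (3 * q - 8/5) (2/pi) * (1 - t powr q)"
proof -
  have "0 < N t q \<and> box_cox (3 * q - 8/5) (N t q) = box_cox (3 * q - 8/5) (2/pi) * (1 - t powr q)"
  proof (cases "q = 8/15")
    case True
    show ?thesis unfolding True by (simp add: N_def box_cox_def ln_powr)
  next
    case False
    define B where "B = (2/pi) powr (3*q - 8/5)"
    \<comment> \<open>For \<open>q < 8/15\<close> the weight \<open>1 - B\<close> is negative; in
      this grouping both summands are positive.\<close>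
    have "0 < B * (1 - t powr q) + t powr q"
      using assms powr_less_mono2[of q t 1] by (auto simp: B_def intro!: add_pos_pos mult_pos_pos)
    then have pos: "0 < B + (1 - B) * t powr q" by (simp add: algebra_simps)
    have p: "3 * q - 8/5 \<noteq> 0" using False by simp
    have "N t q = (B + (1 - B) * t powr q) powr (1 / (3 * q - 8/5))"
      using False by (simp only: N_def B_def if_False)
    moreover have "box_cox (3 * q - 8/5) (2/pi) = (B - 1) / (3 * q - 8/5)"
      using p by (simp only: box_cox_def B_def if_False)
    moreover have "B + (1 - B) * t powr q - 1 = (B - 1) * (1 - t powr q)" by algebra
    ultimately show ?thesis
      using box_cox_powr_inverse[OF p pos] pos by simp
  qed
  then show "0 < N t q" "box_cox (3 * q - 8/5) (N t q) = box_cox (3 * q - 8/5) (2/pi) * (1 - t powr q)"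
    by auto
qed

section \<open>Comparison forms of the monotone l'Hospital rule\<close>

text \<open>\<open>U - L * V\<close> starts at 0 and has derivative \<open>(h - L) * V'\<close>,
  which is negative because an increasing \<open>h\<close> exceeds its limit at
  \<open>a\<close>.\<close>

lemma less_if_deriv_ratio_increasing:
  fixes U V h V' :: "real \<Rightarrow> real"
  assumes x: "a < x" "x < b"
    and cont: "continuous_on {a..x} U" "continuous_on {a..x} V" "U a = 0" "V a = 0"
    and U: "\<And>y. a < y \<Longrightarrow> y < b \<Longrightarrow> (U has_real_derivative h y * V' y) (at y)"
    and V: "\<And>y. a < y \<Longrightarrow> y < b \<Longrightarrow> (V has_real_derivative V' y) (at y)"
    and V': "\<And>y. a < y \<Longrightarrow> y < b \<Longrightarrow> V' y < 0"
    and h: "strict_mono_on {a<..<b} h" and L: "(h \<longlongrightarrow> L) (at_right a)"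
  shows "U x < L * V x"
proof -
  have gt: "L < h y" if y: "a < y" "y < b" for y
  proof -
    \<comment> \<open>The limit alone gives only \<open>L \<le> h z\<close>; the step from
      \<open>z\<close> to \<open>y\<close> makes the inequality strict.\<close>
    define z where "z = (a + y) / 2"
    have z: "a < z" "z < y" using y by (auto simp: z_def)
    have "L \<le> h z"
    proof (rule tendsto_upperbound[OF L])
      show "\<forall>\<^sub>F u in at_right a. h u \<le> h z"
        using z y by (auto simp: eventually_at_right_field intro!: exI[of _ z]
            strict_mono_on_leD[OF h])
    qed simp
    also have "h z < h y" using z y by (intro strict_mono_onD[OF h]) auto
    finally show ?thesis .
  qed
  let ?W = "\<lambda>y. U y - L * V y"
  obtain z where z: "a < z" "z < x" "?W x - ?W a = (x - a) * ((h z - L) * V' z)"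
  proof (rule mvt[OF x(1), of ?W "\<lambda>z d. d * ((h z - L) * V' z)"])
    show "continuous_on {a..x} ?W" by (intro continuous_intros cont)
    show "(?W has_derivative (\<lambda>d. d * ((h z - L) * V' z))) (at z)" if "a < z" "z < x" for z
    proof -
      have "(?W has_real_derivative (h z - L) * V' z) (at z)"
        using U[of z] V[of z] that x by (auto intro!: derivative_eq_intros simp: algebra_simps)
      then show ?thesis unfolding has_field_derivative_def by (rule has_derivative_eq_rhs) (simp add: fun_eq_iff)
    qed
  qed blast
  have "(x - a) * ((h z - L) * V' z) < 0"
    using gt[of z] V'[of z] z x by (intro mult_pos_neg) auto
  then show ?thesis using z cont by simp
qed

text \<open>\<open>U - r * V\<close> vanishes at both ends. Were it nonpositive at \<open>x\<close>,
  mean values on the two sides of \<open>x\<close> would give \<open>h y \<ge> r \<ge> h z\<close>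
  with \<open>y < z\<close>.\<close>

lemma greater_if_deriv_ratio_increasing:
  fixes U V h V' :: "real \<Rightarrow> real"
  assumes x: "a < x" "x < b"
    and cont: "continuous_on {a..b} U" "continuous_on {a..b} V" "U a = 0" "V a = 0"
    and U: "\<And>y. a < y \<Longrightarrow> y < b \<Longrightarrow> (U has_real_derivative h y * V' y) (at y)"
    and V: "\<And>y. a < y \<Longrightarrow> y < b \<Longrightarrow> (V has_real_derivative V' y) (at y)"
    and V': "\<And>y. a < y \<Longrightarrow> y < b \<Longrightarrow> V' y < 0"
    and h: "strict_mono_on {a<..<b} h" and r: "U b = r * V b"
  shows "r * V x < U x"
proof (rule ccontr)
  assume neg: "\<not> r * V x < U x"
  let ?W = "\<lambda>y. U y - r * V y"
  have mv: "\<exists>z. u < z \<and> z < v \<and> ?W v - ?W u = (v - u) * ((h z - r) * V' z)"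
    if "u < v" "a \<le> u" "v \<le> b" for u v
  proof -
    obtain z where "u < z" "z < v" "?W v - ?W u = (v - u) * ((h z - r) * V' z)"
    proof (rule mvt[OF \<open>u < v\<close>, of ?W "\<lambda>z d. d * ((h z - r) * V' z)"])
      show "continuous_on {u..v} ?W"
        using \<open>a \<le> u\<close> \<open>v \<le> b\<close> by (intro continuous_intros continuous_on_subset[OF cont(1)]
            continuous_on_subset[OF cont(2)]) auto
      show "(?W has_derivative (\<lambda>d. d * ((h z - r) * V' z))) (at z)" if "u < z" "z < v" for z
      proof -
        have "(?W has_real_derivative (h z - r) * V' z) (at z)"
          using U[of z] V[of z] that \<open>a \<le> u\<close> \<open>v \<le> b\<close>
          by (auto intro!: derivative_eq_intros simp: algebra_simps)
        then show ?thesis unfolding has_field_derivative_def by (rule has_derivative_eq_rhs) (simp add: fun_eq_iff)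
      qed
    qed blast
    then show ?thesis by blast
  qed
  obtain y where y: "a < y" "y < x" "?W x - ?W a = (x - a) * ((h y - r) * V' y)"
    using mv[of a x] x by auto
  obtain z where z: "x < z" "z < b" "?W b - ?W x = (b - x) * ((h z - r) * V' z)"
    using mv[of x b] x by auto
  have "(x - a) * ((h y - r) * V' y) \<le> 0" using y(3) cont neg by simp
  then have "r \<le> h y"
    using x y V'[of y] by (auto simp: mult_le_0_iff)
  have "0 \<le> (b - x) * ((h z - r) * V' z)" using z(3) r neg by simp
  then have "h z \<le> r"
    using x z V'[of z] by (auto simp: zero_le_mult_iff)
  moreover have "h y < h z"
    using x y z by (intro strict_mono_onD[OF h]) auto
  ultimately show False using \<open>r \<le> h y\<close> by simp
qed

section \<open>Monotonicity of the ratio of derivatives\<close>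

text \<open>The logarithm of \<open>U'/V'\<close>.\<close>

definition log_deriv_ratio :: "real \<Rightarrow> real \<Rightarrow> real" where
  "log_deriv_ratio q x = (3 * q - 18/5) * (ln (sin x) - ln x) + ln (sin x - x * cos x)
     - 3 * ln x + (1 - q) * ln (cos x)"

text \<open>The factors are grouped so that each has a finite nonzero limit at 0;
  \<open>3 * q - 13/5\<close> is the exponent \<open>p - 1\<close> from differentiating
  \<open>U\<close>.\<close>

lemma exp_log_deriv_ratio:
  assumes "0 < x" "x < pi/2"
  shows "exp (log_deriv_ratio q x) = (sin x / x) powr (3 * q - 13/5)
           * ((sin x - x * cos x) / x ^ 3) / (sin x / x) * cos x powr (1 - q)"
proof -
  have pos: "0 < sin x" "0 < cos x" "0 < sin x - x * cos x"
    using assms sin_gt_zero2 cos_gt_zero x_cos_less_sin[of x] by auto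
  have "log_deriv_ratio q x = (3 * q - 13/5) * ln (sin x / x) + ln ((sin x - x * cos x) / x ^ 3)
      - ln (sin x / x) + (1 - q) * ln (cos x)"
    using assms pos by (simp add: log_deriv_ratio_def ln_div ln_realpow field_simps)
  then show ?thesis
    using assms pos by (simp add: exp_add exp_diff powr_def)
qed

lemma DERIV_log_deriv_ratio:
  assumes "0 < x" "x < pi/2"
  shows "(log_deriv_ratio q has_real_derivative
           (3 * q - 18/5) * (cos x / sin x - 1 / x) + x * sin x / (sin x - x * cos x)
           - 3 / x - (1 - q) * (sin x / cos x)) (at x)"
proof -
  have pos: "0 < sin x" "0 < cos x" "0 < sin x - x * cos x"
    using assms sin_gt_zero2 cos_gt_zero x_cos_less_sin[of x] by auto
  show ?thesis
    unfolding log_deriv_ratio_def using assms pos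
    by (auto intro!: derivative_eq_intros simp: divide_simps)
qed

text \<open>This is the coefficient of \<open>q\<close> in the derivative of
  \<open>log_deriv_ratio\<close>. Over a common denominator its numerator is half of
  \<open>three_sin_less\<close> at \<open>2*x\<close>.\<close>

lemma cot_tan_pos:
  fixes x :: real
  assumes "0 < x" "x < pi/2"
  shows "0 < 3 * (cos x / sin x - 1 / x) + sin x / cos x"
proof -
  have pos: "0 < sin x" "0 < cos x"
    using assms sin_gt_zero2 cos_gt_zero by auto
  have "0 < 2 * (2*x) + (2*x) * cos (2*x) - 3 * sin (2*x)"
    using three_sin_less[of "2*x"] assms by simp
  also have "\<dots> = 2 * (3 * x * (cos x)^2 - 3 * sin x * cos x + x * (sin x)^2)"
    unfolding cos_double sin_double using sin_cos_squared_add[of x] by algebra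
  finally have "0 < (3 * x * (cos x)^2 - 3 * sin x * cos x + x * (sin x)^2) / (x * sin x * cos x)"
    using assms pos by simp
  also have "\<dots> = 3 * (cos x / sin x - 1 / x) + sin x / cos x"
    using assms pos by (simp add: field_simps power2_eq_square)
  finally show ?thesis .
qed

text \<open>The value at \<open>q = 1\<close> plus \<open>q - 1\<close> times the positive
  coefficient of \<open>q\<close>. The threshold 1 is natural: for \<open>q < 1\<close> the tangent
  term tends to minus infinity at \<open>pi/2\<close>.\<close>

lemma log_deriv_ratio_deriv_pos:
  fixes x :: real
  assumes "0 < x" "x < pi/2" "1 \<le> q"
  shows "0 < (3 * q - 18/5) * (cos x / sin x - 1 / x) + x * sin x / (sin x - x * cos x)
           - 3 / x - (1 - q) * (sin x / cos x)"
proof -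
  have pos: "0 < sin x" "0 < cos x" "0 < sin x - x * cos x"
    using assms sin_gt_zero2 cos_gt_zero x_cos_less_sin[of x] by auto
  have "0 < 4 * (2*x)^2 - (2*x)^2 * cos (2*x) + 9 * (2*x) * sin (2*x) - 24 + 24 * cos (2*x)"
    using assms by (intro trig_poly_pos_double_angle) auto
  also have "\<dots> = 4 * (5 * x^2 * (sin x)^2 + 3 * x^2 * (cos x)^2 + 9 * x * sin x * cos x - 12 * (sin x)^2)"
    unfolding cos_double sin_double using sin_cos_squared_add[of x] by algebra
  finally have "0 < (5 * x^2 * (sin x)^2 + 3 * x^2 * (cos x)^2 + 9 * x * sin x * cos x - 12 * (sin x)^2)
      / (5 * x * sin x * (sin x - x * cos x))"
    using assms pos by simp
  also have "\<dots> = - 3/5 * (cos x / sin x - 1 / x) + x * sin x / (sin x - x * cos x) - 3 / x"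
    using assms pos by (simp add: divide_simps) algebra
  finally have "0 < \<dots>" .
  moreover have "0 \<le> (q - 1) * (3 * (cos x / sin x - 1 / x) + sin x / cos x)"
    using cot_tan_pos[of x] assms by simp
  ultimately show ?thesis by argo
qed

lemma sin_treble:
  fixes x :: real
  shows "sin (3 * x) = 3 * sin x * (cos x)^2 - (sin x)^3"
proof -
  have "sin (3 * x) = sin (2 * x + x)" by simp
  also have "\<dots> = 3 * sin x * (cos x)^2 - (sin x)^3"
    unfolding sin_add sin_double cos_double by algebra
  finally show ?thesis .
qed

text \<open>At 0 the linear term of this derivative vanishes for every \<open>q\<close> and the
  cubic coefficient is \<open>4/15 * (q - 34/35)\<close>, whence the threshold. Smaller
  \<open>q\<close> follow from the positive coefficient of \<open>q\<close>.\<close>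

lemma log_deriv_ratio_deriv_neg:
  fixes x :: real
  assumes "0 < x" "x < pi/2" "q \<le> 34/35"
  shows "(3 * q - 18/5) * (cos x / sin x - 1 / x) + x * sin x / (sin x - x * cos x)
           - 3 / x - (1 - q) * (sin x / cos x) < 0"
proof -
  have pos: "0 < sin x" "0 < cos x" "0 < sin x - x * cos x"
    using assms sin_gt_zero2 cos_gt_zero x_cos_less_sin[of x] by auto
  have "0 < 81 * cos x - 81 * cos (3*x) - 54 * x * sin x - 58 * x * sin (3*x)
             - 108 * x^2 * cos x + 12 * x^2 * cos (3*x)"
    using assms by (intro trig_poly_pos_triple_angle) auto
  also have "\<dots> = 4 * (81 * (sin x)^2 * cos x + x * (sin x)^3 - 57 * x * sin x * (cos x)^2
      - 24 * x^2 * (cos x)^3 - 36 * x^2 * (sin x)^2 * cos x)"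
    unfolding cos_treble_cos sin_treble using sin_cos_squared_add[of x] by algebra
  finally have "0 < (81 * (sin x)^2 * cos x + x * (sin x)^3 - 57 * x * sin x * (cos x)^2
      - 24 * x^2 * (cos x)^3 - 36 * x^2 * (sin x)^2 * cos x)
      / (35 * x * sin x * cos x * (sin x - x * cos x))"
    using assms pos by simp
  also have "\<dots> = - (- 24/35 * (cos x / sin x - 1 / x) + x * sin x / (sin x - x * cos x) - 3 / x
      - 1/35 * (sin x / cos x))"
    using assms pos by (simp add: divide_simps) algebra
  finally have "0 < \<dots>" .
  moreover have "0 \<le> (34/35 - q) * (3 * (cos x / sin x - 1 / x) + sin x / cos x)"
    using cot_tan_pos[of x] assms by simp
  ultimately show ?thesis by argo
qed

lemma strict_mono_on_exp_log_deriv_ratio: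
  assumes "1 \<le> q"
  shows "strict_mono_on {0<..<pi/2} (\<lambda>x. exp (log_deriv_ratio q x))"
proof (intro strict_mono_onI)
  fix x y :: real assume xy: "x \<in> {0<..<pi/2}" "y \<in> {0<..<pi/2}" "x < y"
  have "log_deriv_ratio q x < log_deriv_ratio q y"
  proof (rule DERIV_pos_imp_increasing[OF \<open>x < y\<close>])
    fix z assume "x \<le> z" "z \<le> y"
    then have "0 < z" "z < pi/2" using xy by auto
    then show "\<exists>d. (log_deriv_ratio q has_real_derivative d) (at z) \<and> 0 < d"
      using DERIV_log_deriv_ratio log_deriv_ratio_deriv_pos assms by blast
  qed
  then show "exp (log_deriv_ratio q x) < exp (log_deriv_ratio q y)" by simp
qed

lemma strict_mono_on_neg_exp_log_deriv_ratio:
  assumes "q \<le> 34/35"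
  shows "strict_mono_on {0<..<pi/2} (\<lambda>x. - exp (log_deriv_ratio q x))"
proof (intro strict_mono_onI)
  fix x y :: real assume xy: "x \<in> {0<..<pi/2}" "y \<in> {0<..<pi/2}" "x < y"
  have "log_deriv_ratio q y < log_deriv_ratio q x"
  proof (rule DERIV_neg_imp_decreasing[OF \<open>x < y\<close>])
    fix z assume "x \<le> z" "z \<le> y"
    then have "0 < z" "z < pi/2" using xy by auto
    then show "\<exists>d. (log_deriv_ratio q has_real_derivative d) (at z) \<and> d < 0"
      using DERIV_log_deriv_ratio log_deriv_ratio_deriv_neg assms by blast
  qed
  then show "- exp (log_deriv_ratio q x) < - exp (log_deriv_ratio q y)" by simp
qed

text \<open>The limit is the factor \<open>1/3\<close> of \<open>box_cox_M\<close> for every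
  \<open>q\<close>, so comparing \<open>U\<close> with the limit times \<open>V\<close> compares
  \<open>sin x / x\<close> with \<open>M\<close>.\<close>

lemma exp_log_deriv_ratio_tendsto:
  "((\<lambda>x. exp (log_deriv_ratio q x)) \<longlongrightarrow> 1/3) (at_right 0)"
proof -
  have 1: "((\<lambda>x::real. sin x / x) \<longlongrightarrow> 1) (at_right 0)" by real_asymp
  have 2: "((\<lambda>x::real. (sin x - x * cos x) / x ^ 3) \<longlongrightarrow> 1/3) (at_right 0)" by real_asymp
  have 3: "((\<lambda>x::real. cos x) \<longlongrightarrow> 1) (at_right 0)" by real_asymp
  have "((\<lambda>x. (sin x / x) powr (3 * q - 13/5) * ((sin x - x * cos x) / x ^ 3) / (sin x / x)
      * cos x powr (1 - q)) \<longlongrightarrow> 1 powr (3 * q - 13/5) * (1/3) / 1 * 1 powr (1 - q)) (at_right 0)"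
    by (intro tendsto_intros 1 2 3) auto
  moreover have "\<forall>\<^sub>F x in at_right 0. (sin x / x) powr (3 * q - 13/5)
      * ((sin x - x * cos x) / x ^ 3) / (sin x / x) * cos x powr (1 - q) = exp (log_deriv_ratio q x)"
    unfolding eventually_at_right_field
    by (rule exI[of _ "pi/2"]) (simp add: exp_log_deriv_ratio)
  ultimately show ?thesis by (simp add: tendsto_cong)
qed

section \<open>Comparison of the transformed functions and the final bounds\<close>

text \<open>Filling the removable singularity makes \<open>U\<close> continuous on the closed
  interval, with \<open>U 0 = 0\<close>.\<close>

definition sinc :: "real \<Rightarrow> real" where
  "sinc x = (if x = 0 then 1 else sin x / x)"

lemma continuous_on_sinc: "continuous_on A sinc"
proof (rule continuous_at_imp_continuous_on, rule ballI)
  fix x :: real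
  show "isCont sinc x"
  proof (cases "x = 0")
    case True
    have "((\<lambda>x::real. sin x / x) \<longlongrightarrow> 1) (at 0)" by real_asymp
    then have "(sinc \<longlongrightarrow> 1) (at 0)"
      by (rule Lim_transform_eventually) (auto simp: sinc_def eventually_at_filter)
    then show ?thesis using True by (simp add: isCont_def sinc_def)
  next
    case False
    have "isCont (\<lambda>x. sin x / x) x" using False by (intro continuous_intros)
    moreover have "\<forall>\<^sub>F y in nhds x. sin y / y = sinc y"
      using t1_space_nhds[OF False] by eventually_elim (simp add: sinc_def)
    ultimately show ?thesis by (simp add: isCont_cong)
  qed
qed

lemma sinc_pos: "0 < sinc x" if "0 \<le> x" "x \<le> pi/2"
proof (cases "x = 0")
  case False
  then have "0 < sin x" using that by (intro sin_gt_zero) auto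
  then show ?thesis using that False by (simp add: sinc_def)
qed (simp add: sinc_def)

text \<open>The derivative is stated as ratio times \<open>V'\<close>, the shape that the l'Hospital
  lemmas take as hypothesis.\<close>

lemma DERIV_box_cox_sinc:
  assumes x: "0 < x" "x < pi/2"
  shows "((\<lambda>x. box_cox (3 * q - 8/5) (sinc x)) has_real_derivative
           exp (log_deriv_ratio q x) * (cos x powr (q - 1) * - sin x)) (at x)"
proof -
  have pos: "0 < sin x" "0 < cos x"
    using assms sin_gt_zero2 cos_gt_zero by auto
  have d: "((\<lambda>x. sin x / x) has_real_derivative (x * cos x - sin x) / x^2) (at x)"
    using x by (auto intro!: derivative_eq_intros simp: power2_eq_square mult.commute)
  have ev: "\<forall>\<^sub>F y in nhds x. sinc y = sin y / y"
    using t1_space_nhds[of x 0] x by (auto elim!: eventually_mono simp: sinc_def)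
  have "(sinc has_real_derivative (x * cos x - sin x) / x^2) (at x)"
    using d DERIV_cong_ev[OF refl ev refl] by blast
  from DERIV_box_cox[OF this, of "3 * q - 8/5"] have
    "((\<lambda>x. box_cox (3 * q - 8/5) (sinc x)) has_real_derivative
       (sin x / x) powr (3 * q - 13/5) * ((x * cos x - sin x) / x^2)) (at x)"
    using x sinc_pos[of x] by (simp add: sinc_def)
  moreover have "cos x powr (1 - q) * cos x powr (q - 1) = 1"
    using pos by (simp flip: powr_add)
  then have "exp (log_deriv_ratio q x) * (cos x powr (q - 1) * - sin x)
     = (sin x / x) powr (3 * q - 13/5) * ((sin x - x * cos x) / x ^ 3) / (sin x / x) * - sin x"
    unfolding exp_log_deriv_ratio[OF x] by algebra
  moreover have "(sin x - x * cos x) / x ^ 3 / (sin x / x) * - sin x = (x * cos x - sin x) / x^2"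
    using x pos by (simp add: field_simps power2_eq_square power3_eq_cube)
  ultimately show ?thesis by (metis mult.assoc times_divide_eq_right)
qed

lemma DERIV_box_cox_cos:
  assumes "0 < x" "x < pi/2"
  shows "((\<lambda>x. box_cox q (cos x)) has_real_derivative cos x powr (q - 1) * - sin x) (at x)"
  using assms cos_gt_zero by (intro DERIV_box_cox) (auto intro!: derivative_eq_intros)

lemma deriv_box_cox_cos_neg:
  assumes "0 < x" "x < pi/2"
  shows "cos x powr (q - 1) * - sin x < (0::real)"
  using assms sin_gt_zero2[of x] cos_gt_zero[of x] by (simp add: mult_pos_pos)

lemma continuous_on_box_cox_sinc:
  "continuous_on {0..pi/2} (\<lambda>x. box_cox p (sinc x))"
  by (rule continuous_on_box_cox_pos) (auto intro: continuous_on_sinc sinc_pos)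

text \<open>The first two bounds use the limit at 0 and stay inside \<open>{0..x}\<close>, so they
  allow \<open>q \<le> 0\<close>. The last two use the values at both ends of
  \<open>{0..pi/2}\<close>. A decreasing ratio is handled by negating \<open>U\<close>.\<close>

lemma box_cox_sinc_bounds:
  assumes x: "0 < x" "x < pi/2"
  defines "U \<equiv> \<lambda>q. box_cox (3 * q - 8/5)"
  shows "1 \<le> q \<Longrightarrow> U q (sin x / x) < box_cox q (cos x) / 3"
    and "q \<le> 34/35 \<Longrightarrow> box_cox q (cos x) / 3 < U q (sin x / x)"
    and "1 \<le> q \<Longrightarrow> U q (2/pi) * (1 - cos x powr q) < U q (sin x / x)"
    and "0 < q \<Longrightarrow> q \<le> 34/35 \<Longrightarrow> U q (sin x / x) < U q (2/pi) * (1 - cos x powr q)"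
proof -
  let ?U = "\<lambda>x. U q (sinc x)" and ?V = "\<lambda>x. box_cox q (cos x)"
  let ?h = "\<lambda>x. exp (log_deriv_ratio q x)" and ?V' = "\<lambda>x. cos x powr (q - 1) * - sin x"
  have U: "(?U has_real_derivative ?h y * ?V' y) (at y)" if "0 < y" "y < pi/2" for y
    unfolding U_def using that by (rule DERIV_box_cox_sinc)
  then have nU: "((\<lambda>x. - ?U x) has_real_derivative - ?h y * ?V' y) (at y)" if "0 < y" "y < pi/2" for y
    using DERIV_minus[OF U[OF that]] by simp
  have V: "(?V has_real_derivative ?V' y) (at y)" if "0 < y" "y < pi/2" for y
    using that by (rule DERIV_box_cox_cos)
  have V': "?V' y < 0" if "0 < y" "y < pi/2" for y
    using that by (rule deriv_box_cox_cos_neg)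
  have contU: "continuous_on {0..pi/2} ?U"
    unfolding U_def by (rule continuous_on_box_cox_sinc)
  have contUx: "continuous_on {0..x} ?U"
    using x by (intro continuous_on_subset[OF contU]) auto
  have contVx: "continuous_on {0..x} ?V"
    using x by (intro continuous_on_box_cox_pos continuous_intros cos_gt_zero_pi) auto
  have contV: "continuous_on {0..pi/2} ?V" if "0 < q"
    using that by (intro continuous_on_box_cox_nonneg continuous_intros cos_ge_zero) auto
  have 0: "?U 0 = 0" "?V 0 = 0" by (auto simp: U_def sinc_def)
  \<comment> \<open>Isabelle's \<open>0 powr q = 0\<close> gives \<open>V(\<pi>/2) = -1/q\<close>, which is the limit of \<open>V\<close> only for \<open>q > 0\<close>.\<close>
  have end_point: "?U (pi/2) = - q * U q (2/pi) * ?V (pi/2)"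
    and rescale: "- q * U q (2/pi) * ?V x = U q (2/pi) * (1 - cos x powr q)" if "0 < q"
    using that by (auto simp: sinc_def box_cox_def[of q] field_simps)
  note sinc_x = sinc_def[of x]
  note lim = exp_log_deriv_ratio_tendsto[of q]
  show "U q (sin x / x) < box_cox q (cos x) / 3" if "1 \<le> q"
    using less_if_deriv_ratio_increasing[OF x contUx contVx 0 U V V'
        strict_mono_on_exp_log_deriv_ratio[OF that] lim] x sinc_x by simp
  show "box_cox q (cos x) / 3 < U q (sin x / x)" if "q \<le> 34/35"
    using less_if_deriv_ratio_increasing[OF x continuous_on_minus[OF contUx] contVx _ 0(2) nU V V'
        strict_mono_on_neg_exp_log_deriv_ratio[OF that] tendsto_minus[OF lim]] 0 x sinc_x by simp
  show "U q (2/pi) * (1 - cos x powr q) < U q (sin x / x)" if "1 \<le> q"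
    using greater_if_deriv_ratio_increasing[OF x contU contV 0 U V V'
        strict_mono_on_exp_log_deriv_ratio[OF that] end_point] rescale that x sinc_x by simp
  show "U q (sin x / x) < U q (2/pi) * (1 - cos x powr q)" if "0 < q" "q \<le> 34/35"
  proof -
    have "- ?U (pi/2) = q * U q (2/pi) * ?V (pi/2)" using end_point[OF that(1)] by simp
    from greater_if_deriv_ratio_increasing[OF x continuous_on_minus[OF contU] contV[OF that(1)] _ 0(2) nU V V'
        strict_mono_on_neg_exp_log_deriv_ratio[OF that(2)] this]
    show ?thesis using 0 rescale[OF that(1)] x sinc_x by simp
  qed
qed

theorem theorem7:
  fixes x q :: real
  assumes "0 < x" and "x < pi/2"
  shows "(1 \<le> q \<longrightarrow> N (cos x) q < sin x / x \<and> sin x / x < M (cos x) q)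
       \<and> (0 < q \<and> q \<le> 34/35 \<longrightarrow> M (cos x) q < sin x / x \<and> sin x / x < N (cos x) q)
       \<and> (q \<le> 0 \<longrightarrow> sin x / x > M (cos x) q)"
proof -
  have t: "0 < cos x" "cos x < 1"
    using assms cos_gt_zero[of x] cos_monotone_0_pi[of 0 x] by auto
  have S: "0 < sin x / x" using assms sin_gt_zero2 by simp
  note M = box_cox_M[OF t, of q] and N = box_cox_N[OF t, of q]
  note iff = box_cox_less_iff[of _ _ "3 * q - 8/5", symmetric]
  note bounds = box_cox_sinc_bounds[OF assms, of q]
  \<comment> \<open>This range covers both the \<open>M\<close> half of (ii) and all of
    (iii).\<close>
  have "M (cos x) q < sin x / x" if "q \<le> 34/35"
    using bounds(2)[OF that] iff[OF M(1) S] M(2) by simp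
  moreover have "sin x / x < M (cos x) q" if "1 \<le> q"
    using bounds(1)[OF that] iff[OF S M(1)] M(2) by simp
  moreover have "N (cos x) q < sin x / x" if "1 \<le> q"
    using bounds(3)[OF that] iff[OF N(1) S] N(2) that by simp
  moreover have "sin x / x < N (cos x) q" if "0 < q" "q \<le> 34/35"
    using bounds(4)[OF that] iff[OF S N(1)] N(2) that by simp
  ultimately show ?thesis by auto
qed

end
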